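(* Let $n,L$ be positive integers. For every positive integer $j$, the number $b_j$ of cycles of length $j$ of the map $\tau(n,L):\mathbb{Z}/L\mathbb{Z}\to\mathbb{Z}/L\mathbb{Z}$, $m\mapsto nm$, is $$b_j=\frac{1}{j}\sum_{d\mid j}\mu\left(\frac{j}{d}\right)\gcd(n^d-1,L).$$
   Context: $\mu$ is the M\"obius function, and $\gcd(0,L)=L$. A cycle of length $j$ of the map $m\mapsto nm$ on $\mathbb{Z}/L\mathbb{Z}$ is a set $\{m,nm,\dots,n^{j-1}m\}\subseteq\mathbb{Z}/L\mathbb{Z}$ consisting of exactly $j$ distinct elements with $n^j m\equiv m \pmod L$. When $\gcd(n,L)=1$ the map is a permutation (the Zolotarev permutation) and these are the cycles of its disjoint cycle decomposition, fixed points being cycles of length $1$. *)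

theory Defs
  imports
    Complex_Main
    "HOL-Computational_Algebra.Primes"
    "HOL-Computational_Algebra.Squarefree"
begin

definition moebius :: "nat \<Rightarrow> int" where
  "moebius k = (if squarefree k then (- 1) ^ card (prime_factors k) else 0)"

(* The ring Z/LZ is represented by its least nonnegative residues {0..<L}. *)
definition zolotarev :: "nat \<Rightarrow> nat \<Rightarrow> nat \<Rightarrow> nat" where
  "zolotarev n L m = (n * m) mod L"

(* A cycle is the underlying set of points, so the choice of starting point x is
   immaterial.  The self-map f of A is not required to be a permutation. *)
definition cycles_of_length :: "('a \<Rightarrow> 'a) \<Rightarrow> 'a set \<Rightarrow> nat \<Rightarrow> 'a set set" where
  "cycles_of_length f A j =
     {C. \<exists>x\<in>A. C = (\<lambda>i. (f ^^ i) x) ` {0..<j} \<and> card C = j \<and> (f ^^ j) x = x}"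

end

theory Submission
  imports Defs
begin

text \<open>
  Call a point \<open>x\<close> with \<open>(f ^^ d) x = x\<close> for some \<open>d > 0\<close> periodic. The least such \<open>d\<close> is the number
  of points of its forward orbit, and it divides every other such \<open>d\<close>
  (\<open>card_forward_orbit_is_period\<close>). So the fixed points of \<open>f ^^ d\<close> are the points that lie on a cycle
  whose length \<open>e\<close> divides \<open>d\<close>. Cycles are disjoint, hence a finite set with \<open>b e\<close> cycles of each
  length \<open>e\<close> contains \<open>\<Sum>e | e dvd d. e * b e\<close> fixed points of \<open>f ^^ d\<close> (\<open>card_fixed_points_funpow\<close>).
  Since this holds for every \<open>d > 0\<close>, Moebius inversion (\<open>moebius_inversion\<close>) expresses \<open>j * b j\<close>
  through the fixed point counts of the iterates \<open>f ^^ d\<close> with \<open>d dvd j\<close>.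

  For \<open>f\<close> the multiplication by \<open>n\<close> on residues modulo \<open>L\<close>, a fixed point of \<open>f ^^ d\<close> is a solution of
  \<open>(n ^ d - 1) * m \<equiv> 0\<close> modulo \<open>L\<close>, and such a linear congruence has \<open>gcd (n ^ d - 1) L\<close> solutions
  (\<open>card_zolotarev_fixed_points\<close>).
\<close>

section \<open>Moebius inversion\<close>

lemma prod_prime_factors_squarefree:
  fixes d :: nat
  assumes "squarefree d"
  shows "\<Prod>(prime_factors d) = d"
proof -
  have "d \<noteq> 0"
    using assms by (metis not_squarefree_0)
  have "(\<Prod>p\<in>prime_factors d. p ^ multiplicity p d) = d"
    using prod_prime_factors[OF \<open>d \<noteq> 0\<close>] by simp
  moreover have "(\<Prod>p\<in>prime_factors d. p ^ multiplicity p d) = \<Prod>(prime_factors d)"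
    using assms \<open>d \<noteq> 0\<close> by (intro prod.cong) (auto simp: squarefree_factorial_semiring')
  ultimately show ?thesis by simp
qed

lemma prime_factors_prod_primes:
  fixes S :: "nat set"
  assumes "finite S" "\<And>p. p \<in> S \<Longrightarrow> prime p"
  shows "prime_factors (\<Prod>S) = S"
proof -
  have "\<Prod>S \<noteq> 0"
    using assms(1) assms(2)[of 0] by auto
  then have "p \<in> prime_factors (\<Prod>S) \<longleftrightarrow> p \<in> S" for p
    using assms by (auto simp: in_prime_factors_iff prime_dvd_prod_iff) (metis primes_dvd_imp_eq)
  then show ?thesis by blast
qed

lemma squarefree_prod_primes:
  fixes S :: "nat set"
  assumes "\<And>p. p \<in> S \<Longrightarrow> prime p"
  shows "squarefree (\<Prod>S)"
  using assms by (intro squarefree_prod_coprime) (auto intro: primes_coprime squarefree_prime)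

text \<open>
  Only squarefree divisors contribute, and they correspond to the sets of prime factors of \<open>n\<close>. If
  \<open>n \<noteq> 1\<close>, there are as many such sets of even as of odd size.
\<close>

lemma sum_moebius_divisors:
  fixes n :: nat
  assumes "n > 0"
  shows "(\<Sum>d | d dvd n. moebius d) = (if n = 1 then 1 else 0)"
proof -
  let ?P = "prime_factors n"
  have dvd: "\<Prod>S dvd n" if "S \<subseteq> ?P" for S
  proof -
    have "\<Prod>S dvd \<Prod>?P"
      using that by (intro prod_dvd_prod_subset) auto
    also have "\<Prod>?P dvd (\<Prod>p\<in>?P. p ^ multiplicity p n)"
      by (intro prod_dvd_prod) (auto simp: prime_factors_multiplicity intro: dvd_power)
    also have "\<dots> = n"
      using prod_prime_factors[of n] assms by simp
    finally show ?thesis .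
  qed
  have "(\<Sum>d | d dvd n. moebius d) = (\<Sum>d | d dvd n \<and> squarefree d. moebius d)"
    using assms by (intro sum.mono_neutral_right) (auto simp: moebius_def)
  also have "\<dots> = (\<Sum>S\<in>Pow ?P. (- 1) ^ card S)"
  proof (rule sum.reindex_bij_witness[where i = "\<lambda>S. \<Prod>S" and j = prime_factors])
    fix d assume d: "d \<in> {d. d dvd n \<and> squarefree d}"
    show "\<Prod>(prime_factors d) = d"
      using d prod_prime_factors_squarefree by blast
    show "prime_factors d \<in> Pow ?P"
      using d assms by (auto intro: dvd_prime_factors[THEN subsetD])
    show "(- 1) ^ card (prime_factors d) = moebius d"
      using d by (simp add: moebius_def)
  next
    fix S assume S: "S \<in> Pow ?P"
    then have "finite S" and primes: "\<And>p. p \<in> S \<Longrightarrow> prime p"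
      by (auto intro: finite_subset)
    then show "prime_factors (\<Prod>S) = S"
      by (rule prime_factors_prod_primes)
    show "\<Prod>S \<in> {d. d dvd n \<and> squarefree d}"
      using S dvd squarefree_prod_primes[OF primes] by blast
  qed
  also have "\<dots> = (if n = 1 then 1 else 0)"
  proof (cases "n = 1")
    case False
    then have "?P \<noteq> {}"
      using assms by (simp add: prime_factorization_empty_iff)
    then have "(\<Sum>S\<in>Pow ?P. (- 1 :: int) ^ card S) = 0"
      using card_subsupersets_even_odd[of ?P "{}"]
      by (intro sum_alternating_cancels) (auto simp: psubset_eq)
    then show ?thesis
      using False by simp
  qed simp
  finally show ?thesis .
qed

lemma moebius_inversion:
  fixes F g :: "nat \<Rightarrow> int"
  assumes "j > 0" and F: "\<And>d. d dvd j \<Longrightarrow> F d = (\<Sum>e | e dvd d. g e)"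
  shows "(\<Sum>d | d dvd j. moebius (j div d) * F d) = g j"
proof -
  have fin: "finite {d. d dvd j}"
    using \<open>j > 0\<close> by simp
  have sub: "{e. e dvd j \<and> e dvd d} = {e. e dvd d}" if "d dvd j" for d
    using that by (auto intro: dvd_trans)
  have "(\<Sum>d | d dvd j. moebius (j div d) * F d) =
      (\<Sum>d | d dvd j. \<Sum>e | e dvd j \<and> e dvd d. moebius (j div d) * g e)"
    by (intro sum.cong) (simp_all add: F sub sum_distrib_left)
  also have "\<dots> = (\<Sum>e | e dvd j. \<Sum>d | d dvd j \<and> e dvd d. moebius (j div d) * g e)"
    using sum.swap_restrict[OF fin fin, of "\<lambda>d e. moebius (j div d) * g e" "\<lambda>d e. e dvd d"] by simp
  also have "\<dots> = (\<Sum>e | e dvd j. if e = j then g e else 0)"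
  proof (rule sum.cong)
    fix e assume "e \<in> {e. e dvd j}"
    then obtain k where k: "j = e * k" by auto
    with \<open>j > 0\<close> have "e > 0" "k > 0" by auto
    \<comment> \<open>The divisors of \<open>j\<close> that are multiples of \<open>e\<close> are \<open>j div c\<close> for the divisors \<open>c\<close> of \<open>k = j div e\<close>.\<close>
    have "(\<Sum>d | d dvd j \<and> e dvd d. moebius (j div d) * g e) = (\<Sum>c | c dvd k. moebius c * g e)"
      by (rule sum.reindex_bij_witness[where i = "\<lambda>c. j div c" and j = "\<lambda>d. j div d"])
        (use \<open>e > 0\<close> \<open>k > 0\<close> in \<open>auto simp: k dvd_def\<close>)
    also have "\<dots> = (\<Sum>c | c dvd k. moebius c) * g e"
      by (simp add: sum_distrib_right)
    also have "\<dots> = (if e = j then g e else 0)"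
      using \<open>e > 0\<close> \<open>k > 0\<close> by (simp add: sum_moebius_divisors k)
    finally show "(\<Sum>d | d dvd j \<and> e dvd d. moebius (j div d) * g e) = (if e = j then g e else 0)" .
  qed simp
  also have "\<dots> = g j"
    using fin by simp
  finally show ?thesis .
qed

section \<open>Periodic points and cycles\<close>

definition forward_orbit :: "('a \<Rightarrow> 'a) \<Rightarrow> 'a \<Rightarrow> 'a set" where
  "forward_orbit f x = range (\<lambda>i. (f ^^ i) x)"

lemma self_in_forward_orbit: "x \<in> forward_orbit f x"
  unfolding forward_orbit_def by (rule range_eqI[of _ _ 0]) simp

lemma forward_orbit_eq_image:
  assumes "(f ^^ d) x = x" and "d > 0"
  shows "forward_orbit f x = (\<lambda>i. (f ^^ i) x) ` {0..<d}"
proof -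
  have "(f ^^ i) x \<in> (\<lambda>i. (f ^^ i) x) ` {0..<d}" for i
    using assms by (intro image_eqI[of _ _ "i mod d"]) (simp_all add: funpow_mod_eq)
  then show ?thesis
    by (auto simp: forward_orbit_def)
qed

text \<open>
  The size of the orbit of a periodic point is its least period. If the first \<open>e\<close> iterates had a repetition,
  where \<open>e\<close> is the least positive period, then applying \<open>f\<close> further would return to \<open>x\<close> in fewer than
  \<open>e\<close> steps.
\<close>

lemma card_forward_orbit_is_period:
  assumes "(f ^^ d) x = x" and "d > 0"
  defines "e \<equiv> card (forward_orbit f x)"
  shows "e > 0" and "(f ^^ e) x = x" and "e dvd d"
proof -
  define p where "p = (LEAST p. p > 0 \<and> (f ^^ p) x = x)"
  have p: "p > 0" "(f ^^ p) x = x"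
    using LeastI[of "\<lambda>p. p > 0 \<and> (f ^^ p) x = x" d] assms by (simp_all add: p_def)
  have least: "p \<le> q" if "q > 0" "(f ^^ q) x = x" for q
    unfolding p_def using that by (intro Least_le) simp
  have no_repeat: "(f ^^ a) x \<noteq> (f ^^ b) x" if "a < b" "b < p" for a b
  proof
    assume eq: "(f ^^ a) x = (f ^^ b) x"
    have "(f ^^ (p - b + a)) x = (f ^^ (p - b)) ((f ^^ b) x)"
      by (simp add: funpow_add eq)
    also have "\<dots> = (f ^^ (p - b + b)) x"
      by (simp only: funpow_add o_apply)
    also have "\<dots> = x"
      using p that by simp
    finally have "p \<le> p - b + a"
      using that by (intro least) auto
    with that show False by simp
  qed
  have "inj_on (\<lambda>i. (f ^^ i) x) {0..<p}"
    using no_repeat by (intro linorder_inj_onI) auto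
  then have [simp]: "e = p"
    using p by (simp add: e_def forward_orbit_eq_image[of p f] card_image)
  show "e > 0" "(f ^^ e) x = x"
    using p by simp_all
  have "(f ^^ (d mod p)) x = x"
    using p assms by (simp add: funpow_mod_eq)
  then have "d mod p = 0"
    using least[of "d mod p"] p by (metis bot_nat_0.not_eq_extremum mod_less_divisor not_le)
  then show "e dvd d" by auto
qed

text \<open>
  Iterating further leads from any point of the orbit back to \<open>x\<close>, so all points of the orbit have
  the same orbit. This makes distinct cycles disjoint.
\<close>

lemma forward_orbit_eq:
  assumes "(f ^^ d) x = x" and "d > 0" and "y \<in> forward_orbit f x"
  shows "(f ^^ d) y = y" and "forward_orbit f y = forward_orbit f x"
proof -
  obtain a where a: "a < d" "y = (f ^^ a) x"
    using assms by (auto simp: forward_orbit_eq_image)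
  show per: "(f ^^ d) y = y"
    using assms(1) by (metis a(2) add.commute comp_apply funpow_add)
  have sub: "forward_orbit f v \<subseteq> forward_orbit f u" if "v \<in> forward_orbit f u" for u v
    using that by (auto simp: forward_orbit_def simp flip: funpow_add o_apply[of "f ^^ _" "f ^^ _"])
  have "x = (f ^^ (d - a)) y"
    using a assms(1) by (metis comp_apply funpow_add le_add_diff_inverse2 less_imp_le)
  then have "x \<in> forward_orbit f y"
    by (auto simp: forward_orbit_def)
  with assms(3) show "forward_orbit f y = forward_orbit f x"
    by (intro equalityI sub)
qed

definition points_of_period :: "('a \<Rightarrow> 'a) \<Rightarrow> 'a set \<Rightarrow> nat \<Rightarrow> 'a set" where
  "points_of_period f A e = {x \<in> A. (f ^^ e) x = x \<and> card (forward_orbit f x) = e}"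

lemma cycles_of_length_eq_orbits:
  assumes "e > 0"
  shows "cycles_of_length f A e = forward_orbit f ` points_of_period f A e"
proof -
  have "C = (\<lambda>i. (f ^^ i) x) ` {0..<e} \<and> card C = e \<and> (f ^^ e) x = x \<longleftrightarrow>
      C = forward_orbit f x \<and> (f ^^ e) x = x \<and> card (forward_orbit f x) = e" for C x
    using forward_orbit_eq_image[of e f x] assms by metis
  then show ?thesis
    by (auto simp: cycles_of_length_def points_of_period_def image_iff)
qed

lemma card_points_of_period:
  assumes "finite A" and "f ` A \<subseteq> A" and "e > 0"
  shows "card (points_of_period f A e) = e * card (cycles_of_length f A e)"
proof -
  let ?P = "points_of_period f A e" and ?C = "cycles_of_length f A e"
  have finP: "finite ?P"
    using \<open>finite A\<close> by (simp add: points_of_period_def)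
  have iter: "(f ^^ i) x \<in> A" if "x \<in> A" for i x
    using that assms(2) by (induction i) auto
  have closed: "y \<in> ?P" if "x \<in> ?P" "y \<in> forward_orbit f x" for x y
    using that forward_orbit_eq[of e f x y] iter \<open>e > 0\<close>
    by (auto simp: points_of_period_def forward_orbit_def)
  then have union: "\<Union>?C = ?P"
    using self_in_forward_orbit by (fastforce simp: cycles_of_length_eq_orbits \<open>e > 0\<close>)
  have "e * card ?C = card (\<Union>?C)"
  proof (rule card_partition)
    show "finite ?C"
      using finP by (simp add: cycles_of_length_eq_orbits \<open>e > 0\<close>)
    show "finite (\<Union>?C)"
      using finP union by simp
    show "card C = e" if "C \<in> ?C" for C
      using that by (auto simp: cycles_of_length_def)
    show "C \<inter> D = {}" if CD: "C \<in> ?C" "D \<in> ?C" "C \<noteq> D" for C D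
    proof (rule ccontr)
      assume "C \<inter> D \<noteq> {}"
      then obtain z where "z \<in> C" "z \<in> D" by blast
      moreover obtain x y where "C = forward_orbit f x" "D = forward_orbit f y" "x \<in> ?P" "y \<in> ?P"
        using CD by (auto simp: cycles_of_length_eq_orbits \<open>e > 0\<close>)
      ultimately have "C = forward_orbit f z" "D = forward_orbit f z"
        using forward_orbit_eq(2)[of e f] \<open>e > 0\<close> by (auto simp: points_of_period_def)
      with CD show False by simp
    qed
  qed
  with union show ?thesis by simp
qed

lemma card_fixed_points_funpow:
  assumes "finite A" and "f ` A \<subseteq> A" and "d > 0"
  shows "card {x \<in> A. (f ^^ d) x = x} = (\<Sum>e | e dvd d. e * card (cycles_of_length f A e))"
proof -
  have "{x \<in> A. (f ^^ d) x = x} = (\<Union>e\<in>{e. e dvd d}. points_of_period f A e)"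
  proof (intro equalityI subsetI)
    fix x assume "x \<in> {x \<in> A. (f ^^ d) x = x}"
    then show "x \<in> (\<Union>e\<in>{e. e dvd d}. points_of_period f A e)"
      using card_forward_orbit_is_period[of d f x] \<open>d > 0\<close> by (auto simp: points_of_period_def)
  next
    fix x assume "x \<in> (\<Union>e\<in>{e. e dvd d}. points_of_period f A e)"
    then obtain e where "e dvd d" "x \<in> A" "(f ^^ e) x = x"
      by (auto simp: points_of_period_def)
    moreover from this have "(f ^^ d) x = x"
      using funpow_mod_eq[of e f x d] by (simp add: dvd_imp_mod_0)
    ultimately show "x \<in> {x \<in> A. (f ^^ d) x = x}" by simp
  qed
  also have "card \<dots> = (\<Sum>e | e dvd d. card (points_of_period f A e))"
    using assms by (intro card_UN_disjoint) (auto simp: points_of_period_def)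
  also have "\<dots> = (\<Sum>e | e dvd d. e * card (cycles_of_length f A e))"
    using assms by (intro sum.cong card_points_of_period) (auto intro: dvd_pos_nat)
  finally show ?thesis .
qed

section \<open>Fixed points of multiplication modulo \<open>L\<close>\<close>

text \<open>
  With \<open>g = gcd k L\<close>, the solutions are the \<open>g\<close> multiples of \<open>L div g\<close> below \<open>L\<close>.
\<close>

lemma card_linear_congruence_solutions:
  fixes k L :: nat
  assumes "L > 0"
  shows "card {m \<in> {0..<L}. L dvd k * m} = gcd k L"
proof -
  define g where "g = gcd k L"
  have "g > 0"
    using assms by (simp add: g_def)
  obtain a c where ac: "k = a * g" "L = c * g" "coprime a c"
    using gcd_coprime_exists[of k L] \<open>g > 0\<close> unfolding g_def by blast
  have "c > 0"
    using assms ac by auto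
  have "L dvd k * m \<longleftrightarrow> c dvd m" for m
  proof -
    have "L dvd k * m \<longleftrightarrow> g * c dvd g * (a * m)"
      by (simp add: ac(1,2) ac_simps)
    also have "\<dots> \<longleftrightarrow> c dvd a * m"
      using \<open>g > 0\<close> by simp
    also have "\<dots> \<longleftrightarrow> c dvd m"
      using ac(3) by (simp add: coprime_dvd_mult_right_iff coprime_commute[of c a])
    finally show ?thesis .
  qed
  then have "{m \<in> {0..<L}. L dvd k * m} = (\<lambda>i. c * i) ` {0..<g}"
    using \<open>c > 0\<close> by (auto simp: ac(2) mult.commute[of c] elim!: dvdE)
  also have "card \<dots> = g"
    using \<open>c > 0\<close> by (subst card_image) (auto simp: inj_on_def)
  finally show ?thesis
    by (simp add: g_def)
qed

lemma zolotarev_funpow: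
  assumes "m < L"
  shows "(zolotarev n L ^^ d) m = n ^ d * m mod L"
  using assms by (induction d) (simp_all add: zolotarev_def mod_mult_right_eq mult.assoc)

lemma card_zolotarev_fixed_points:
  assumes "n > 0" and "L > 0"
  shows "int (card {m \<in> {0..<L}. (zolotarev n L ^^ d) m = m}) = gcd (int n ^ d - 1) (int L)"
proof -
  have "n ^ d \<ge> 1"
    using assms by simp
  have "(zolotarev n L ^^ d) m = m \<longleftrightarrow> L dvd (n ^ d - 1) * m" if "m < L" for m
  proof -
    have "(zolotarev n L ^^ d) m = m \<longleftrightarrow> n ^ d * m mod L = m mod L"
      using that by (simp add: zolotarev_funpow)
    also have "\<dots> \<longleftrightarrow> L dvd n ^ d * m - m"
      using \<open>n ^ d \<ge> 1\<close> by (intro mod_eq_dvd_iff_nat) simp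
    also have "n ^ d * m - m = (n ^ d - 1) * m"
      by (simp add: diff_mult_distrib)
    finally show ?thesis .
  qed
  then have "{m \<in> {0..<L}. (zolotarev n L ^^ d) m = m} = {m \<in> {0..<L}. L dvd (n ^ d - 1) * m}"
    by auto
  then have "int (card {m \<in> {0..<L}. (zolotarev n L ^^ d) m = m}) = int (gcd (n ^ d - 1) L)"
    using card_linear_congruence_solutions[OF \<open>L > 0\<close>] by simp
  also have "\<dots> = gcd (int n ^ d - 1) (int L)"
    using \<open>n ^ d \<ge> 1\<close> by (simp add: of_nat_diff flip: gcd_int_int_eq)
  finally show ?thesis .
qed

theorem lemma3:
  fixes n L j :: nat
  assumes "n > 0" and "L > 0" and "j > 0"
  shows "real (card (cycles_of_length (zolotarev n L) {0..<L} j)) =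
    1 / real j * (\<Sum>d | d dvd j. real_of_int (moebius (j div d) * gcd (int n ^ d - 1) (int L)))"
proof -
  let ?b = "\<lambda>e. card (cycles_of_length (zolotarev n L) {0..<L} e)"
  have "gcd (int n ^ d - 1) (int L) = (\<Sum>e | e dvd d. int (e * ?b e))" if "d dvd j" for d
  proof -
    have "d > 0"
      using that \<open>j > 0\<close> by (auto intro: dvd_pos_nat)
    then show ?thesis
      using card_fixed_points_funpow[of "{0..<L}" "zolotarev n L" d] \<open>L > 0\<close>
      by (simp add: zolotarev_def image_subset_iff
          flip: card_zolotarev_fixed_points[OF \<open>n > 0\<close> \<open>L > 0\<close>])
  qed
  then have "(\<Sum>d | d dvd j. moebius (j div d) * gcd (int n ^ d - 1) (int L)) = int (j * ?b j)"
    using \<open>j > 0\<close> by (intro moebius_inversion) auto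
  then have "(\<Sum>d | d dvd j. real_of_int (moebius (j div d) * gcd (int n ^ d - 1) (int L))) =
      real j * real (?b j)"
    by (metis of_int_of_nat_eq of_int_sum of_nat_mult)
  then show ?thesis
    using \<open>j > 0\<close> by simp
qed

end
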